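(* For $n\ge1$ let $y_n$ be the number of rows with value $0$ in the truth tables of all bracketed m-implications with $n$ distinct variables (defined in the context). Then, as $n\to\infty$, \[ y_n\sim\left(\frac{10-2\sqrt{10}}{10}\right)\frac{2^{3n-2}}{\sqrt{\pi n^3}}. \]
   Context: Truth values are $1$ (true), $0$ (false). The connective $\rightharpoonup$ satisfies $\nu(\phi\rightharpoonup\psi)=0$ iff $\nu(\phi)=\nu(\psi)=1$, and $=1$ otherwise (i.e. $\phi\rightharpoonup\psi\equiv\phi\to\neg\psi$). A bracketed m-implication with $n$ variables is a well-formed formula obtained from $p_1\rightharpoonup p_2\rightharpoonup\cdots\rightharpoonup p_n$ ($p_i$ distinct variables, in this order) by inserting brackets. $y_n$ is the total, over all such formulae $\phi$, of the number of valuations $\nu$ of $p_1,\dots,p_n$ with $\nu(\phi)=0$. Here $a_n\sim b_n$ means $a_n/b_n\to1$. *)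

theory Defs
  imports Complex_Main "HOL-Library.FuncSet" "HOL-Library.Landau_Symbols"
begin

text \<open>
  Formulae built from variables \<open>p\<^sub>i\<close> (\<open>PVar i\<close>) with the single binary connective
  m-implication (\<open>MImp\<close>). Brackets are represented by the tree structure.
\<close>

datatype mformula = PVar nat | MImp mformula mformula

text \<open>The truth values 1 and 0 are \<open>True\<close> and \<open>False\<close>.\<close>

primrec meval :: "(nat \<Rightarrow> bool) \<Rightarrow> mformula \<Rightarrow> bool" where
  "meval \<nu> (PVar i) = \<nu> i"
| "meval \<nu> (MImp \<phi> \<psi>) = (\<not> (meval \<nu> \<phi> \<and> meval \<nu> \<psi>))"

text \<open>Erasing the brackets leaves the sequence of variables, read from left to right.\<close>

primrec var_seq :: "mformula \<Rightarrow> nat list" where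
  "var_seq (PVar i) = [i]"
| "var_seq (MImp \<phi> \<psi>) = var_seq \<phi> @ var_seq \<psi>"

definition bracketed_mimps :: "nat \<Rightarrow> mformula set" where
  "bracketed_mimps n = {\<phi>. var_seq \<phi> = [1..<Suc n]}"

text \<open>
  A row of the truth table in \<open>p\<^sub>1, \<dots>, p\<^sub>n\<close> is a valuation of exactly these variables;
  \<open>\<rightarrow>\<^sub>E\<close> fixes the values at irrelevant indices, so that there are \<open>2 ^ n\<close> rows.
\<close>

definition valuations :: "nat \<Rightarrow> (nat \<Rightarrow> bool) set" where
  "valuations n = {1..n} \<rightarrow>\<^sub>E UNIV"

definition false_rows :: "nat \<Rightarrow> mformula \<Rightarrow> (nat \<Rightarrow> bool) set" where
  "false_rows n \<phi> = {\<nu> \<in> valuations n. \<not> meval \<nu> \<phi>}"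

definition y_num :: "nat \<Rightarrow> nat" where
  "y_num n = (\<Sum>\<phi>\<in>bracketed_mimps n. card (false_rows n \<phi>))"

text \<open>The sets that are summed over and counted in \<open>y_num\<close> are finite.\<close>

lemma finite_valuations: "finite (valuations n)"
  by (simp add: valuations_def finite_PiE)

lemma card_valuations: "card (valuations n) = 2 ^ n"
  by (simp add: valuations_def card_PiE)

lemma var_seq_nonempty: "var_seq \<phi> \<noteq> []"
  by (induction \<phi>) auto

lemma finite_var_seq: "finite {\<phi>. var_seq \<phi> = xs}"
proof (induction xs rule: length_induct)
  case (1 xs)
  define S where "S k = (\<lambda>(\<phi>, \<psi>). MImp \<phi> \<psi>) `
    ({\<phi>. var_seq \<phi> = take k xs} \<times> {\<psi>. var_seq \<psi> = drop k xs})" for k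
  have "finite (S k)" if "k \<in> {0<..<length xs}" for k
    unfolding S_def using that 1 by (intro finite_imageI finite_cartesian_product) auto
  then have fin: "finite (PVar ` set xs \<union> (\<Union>k\<in>{0<..<length xs}. S k))"
    by blast
  have "{\<phi>. var_seq \<phi> = xs} \<subseteq> PVar ` set xs \<union> (\<Union>k\<in>{0<..<length xs}. S k)"
  proof
    fix \<phi> assume "\<phi> \<in> {\<phi>. var_seq \<phi> = xs}"
    then have xs: "xs = var_seq \<phi>" by simp
    show "\<phi> \<in> PVar ` set xs \<union> (\<Union>k\<in>{0<..<length xs}. S k)"
    proof (cases \<phi>)
      case (PVar i)
      then show ?thesis using xs by simp
    next
      case (MImp \<alpha> \<beta>)
      have "\<phi> \<in> S (length (var_seq \<alpha>))"
        using MImp xs by (auto simp: S_def)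
      moreover have "length (var_seq \<alpha>) \<in> {0<..<length xs}"
        using MImp xs var_seq_nonempty by simp
      ultimately show ?thesis by blast
    qed
  qed
  then show ?case using fin by (rule finite_subset)
qed

lemma finite_bracketed_mimps: "finite (bracketed_mimps n)"
  unfolding bracketed_mimps_def by (rule finite_var_seq)

lemma finite_false_rows: "finite (false_rows n \<phi>)"
  unfolding false_rows_def by (simp add: finite_valuations)

end

theory Submission
  imports Defs "HOL-Analysis.Gamma_Function" "HOL-Real_Asymp.Real_Asymp"
    "HOL-Computational_Algebra.Formal_Power_Series"
begin

text \<open>
  Let \<open>g\<^sub>n\<close> and \<open>t\<^sub>n\<close> count all rows and the true rows. Splitting a formula at its root
  gives \<open>g\<^sub>n = \<Sum> g\<^sub>k g\<^bsub>n-k\<^esub>\<close> and \<open>g\<^sub>n - t\<^sub>n = \<Sum> t\<^sub>k t\<^bsub>n-k\<^esub>\<close> for \<open>n \<ge> 2\<close>. The first recurrence is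
  solved by binomial coefficients of exponent \<open>1/2\<close>, so that \<open>g\<^sub>n \<sim> 8\<^sup>n / (4 \<surd>(\<pi> n\<^sup>3))\<close>. For the
  second one, put \<open>S = \<Sum> t\<^sub>n / 8\<^sup>n\<close>. Since only the two ends of the convolution contribute
  asymptotically, \<open>\<tau>\<^sub>n = t\<^sub>n / g\<^sub>n\<close> satisfies \<open>\<tau>\<^sub>n = 1 - 2 (\<Sum>\<^bsub>k<K\<^esub> 8\<^sup>-\<^sup>k t\<^sub>k \<tau>\<^bsub>n-k\<^esub>)\<close> up to a small
  error. As \<open>2 S < 1\<close>, this is a contraction around the fixed point \<open>1 / (1 + 2 S)\<close>, to which
  \<open>\<tau>\<^sub>n\<close> therefore converges. Finally \<open>S + S\<^sup>2 + 1/8 = 1/2\<close> yields \<open>1 + 2 S = \<surd>(5/2)\<close>.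
\<close>

subsection \<open>Truth table rows of bracketings\<close>

text \<open>Formulae are paired with valuations over an arbitrary list of variables, because cutting
  a formula at its root produces lists that do not start at 1. The set \<open>A\<close> selects all
  rows, the true rows or the false rows.\<close>

definition rows :: "nat list \<Rightarrow> bool set \<Rightarrow> (mformula \<times> (nat \<Rightarrow> bool)) set" where
  "rows xs A = {(\<phi>, \<nu>). var_seq \<phi> = xs \<and> \<nu> \<in> set xs \<rightarrow>\<^sub>E UNIV \<and> meval \<nu> \<phi> \<in> A}"

lemma finite_rows: "finite (rows xs A)"
proof (rule finite_subset)
  show "rows xs A \<subseteq> {\<phi>. var_seq \<phi> = xs} \<times> (set xs \<rightarrow>\<^sub>E UNIV)"
    by (auto simp: rows_def)
  show "finite ({\<phi>. var_seq \<phi> = xs} \<times> (set xs \<rightarrow>\<^sub>E (UNIV :: bool set)))"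
    by (intro finite_cartesian_product finite_var_seq finite_PiE) auto
qed

lemma y_num_eq_card_rows: "y_num n = card (rows [1..<Suc n] {False})"
proof -
  have "rows [1..<Suc n] {False} = (SIGMA \<phi>:bracketed_mimps n. false_rows n \<phi>)"
    by (auto simp: rows_def bracketed_mimps_def false_rows_def valuations_def
        atLeastLessThanSuc_atLeastAtMost simp del: upt_Suc)
  then show ?thesis
    by (simp add: y_num_def card_SigmaI finite_bracketed_mimps finite_false_rows)
qed

lemma card_rows_UNIV: "card (rows xs UNIV) = card (rows xs {True}) + card (rows xs {False})"
proof -
  have "rows xs UNIV = rows xs {True} \<union> rows xs {False}"
    by (auto simp: rows_def)
  moreover have "rows xs {True} \<inter> rows xs {False} = {}"
    by (auto simp: rows_def)
  ultimately show ?thesis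
    by (simp add: card_Un_disjoint finite_rows)
qed

lemma card_rows_singleton: "card (rows [i] A) = card A"
proof -
  have "var_seq \<phi> = [i] \<longleftrightarrow> \<phi> = PVar i" for \<phi>
    by (cases \<phi>) (auto simp: append_eq_Cons_conv var_seq_nonempty)
  then have "rows [i] A = {PVar i} \<times> {\<nu> \<in> {i} \<rightarrow>\<^sub>E UNIV. \<nu> i \<in> A}"
    by (auto simp: rows_def)
  also have "{\<nu> \<in> {i} \<rightarrow>\<^sub>E UNIV. \<nu> i \<in> A} = {i} \<rightarrow>\<^sub>E A"
    by (auto simp: PiE_def)
  finally show ?thesis
    by (simp add: card_cartesian_product card_PiE)
qed

section \<open>Cutting a row at the root of its formula\<close>

lemma meval_cong: "(\<And>i. i \<in> set (var_seq \<phi>) \<Longrightarrow> \<nu> i = \<mu> i) \<Longrightarrow> meval \<nu> \<phi> = meval \<mu> \<phi>"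
  by (induction \<phi>) auto

text \<open>The inverse of cutting at the root. Outside both variable lists the value is that of
  \<open>\<mu>\<close>, so the glued valuation stays extensional.\<close>

fun join_rows where
  "join_rows ((\<phi>, \<nu>), (\<psi>, \<mu>)) = (MImp \<phi> \<psi>, \<lambda>i. if i \<in> set (var_seq \<phi>) then \<nu> i else \<mu> i)"

lemma inj_on_join_rows:
  assumes "set xs \<inter> set ys = {}"
  shows "inj_on join_rows (rows xs A \<times> rows ys B)"
proof (rule inj_onI)
  fix p q assume *: "p \<in> rows xs A \<times> rows ys B" "q \<in> rows xs A \<times> rows ys B" "join_rows p = join_rows q"
  obtain \<phi> \<nu> \<psi> \<mu> where p: "p = ((\<phi>, \<nu>), (\<psi>, \<mu>))" by (metis prod.exhaust)
  obtain \<phi>' \<nu>' \<psi>' \<mu>' where q: "q = ((\<phi>', \<nu>'), (\<psi>', \<mu>'))" by (metis prod.exhaust)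
  have eq: "\<phi> = \<phi>'" "\<psi> = \<psi>'"
    and m: "(if i \<in> set xs then \<nu> i else \<mu> i) = (if i \<in> set xs then \<nu>' i else \<mu>' i)" for i
    using * by (auto simp: p q rows_def fun_eq_iff)
  have ext: "\<nu> \<in> extensional (set xs)" "\<nu>' \<in> extensional (set xs)"
      "\<mu> \<in> extensional (set ys)" "\<mu>' \<in> extensional (set ys)"
    using * by (auto simp: p q rows_def PiE_def)
  have "\<nu> i = \<nu>' i" for i
    using m[of i] ext(1,2) by (cases "i \<in> set xs") (auto simp: extensional_def)
  moreover have "\<mu> i = \<mu>' i" for i
  \<comment> \<open>Gluing hides the value of \<open>\<mu>\<close> on \<open>xs\<close>, but by
    disjointness such an index lies outside \<open>ys\<close>, where \<open>\<mu>\<close> and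
    \<open>\<mu>'\<close> are both \<open>undefined\<close>.\<close>
  proof (cases "i \<in> set xs")
    case True
    then have "i \<notin> set ys" using assms by blast
    then show ?thesis using ext(3,4) by (simp add: extensional_def)
  next
    case False
    then show ?thesis using m[of i] by simp
  qed
  ultimately show "p = q"
    using eq by (auto simp: p q fun_eq_iff)
qed

text \<open>With at least two variables the root is \<open>MImp\<close>, and the cut
  \<open>k\<close> is the number of variables to its left. The condition on \<open>A\<close> and
  \<open>C\<close> covers two cases at once: all rows come from arbitrary pairs of rows, and false
  rows come exactly from pairs of true rows.\<close>

lemma rows_split:
  assumes "2 \<le> length xs" "distinct xs"
    and AC: "\<And>a b. (\<not> (a \<and> b)) \<in> C \<longleftrightarrow> a \<in> A \<and> b \<in> A"
  shows "rows xs C =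
    (\<Union>k\<in>{1..<length xs}. join_rows ` (rows (take k xs) A \<times> rows (drop k xs) A))"
    (is "_ = (\<Union>k\<in>_. ?J k)")
proof (intro Set.equalityI subsetI)
  fix p assume "p \<in> rows xs C"
  then obtain \<phi> \<nu> where p: "p = (\<phi>, \<nu>)" and xs: "var_seq \<phi> = xs"
    and \<nu>: "\<nu> \<in> set xs \<rightarrow>\<^sub>E UNIV" and ev: "meval \<nu> \<phi> \<in> C"
    by (auto simp: rows_def)
  obtain \<alpha> \<beta> where \<phi>: "\<phi> = MImp \<alpha> \<beta>"
    using assms(1) xs by (cases \<phi>) auto
  define k where "k = length (var_seq \<alpha>)"
  have k: "take k xs = var_seq \<alpha>" "drop k xs = var_seq \<beta>" "k \<in> {1..<length xs}"
    using xs \<phi> var_seq_nonempty[of \<alpha>] var_seq_nonempty[of \<beta>] by (auto simp: k_def Suc_le_eq)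
  \<comment> \<open>Restriction makes the two halves extensional on their own variables, as
    membership in \<open>rows\<close> demands.\<close>
  define \<nu>1 where "\<nu>1 = restrict \<nu> (set (var_seq \<alpha>))"
  define \<nu>2 where "\<nu>2 = restrict \<nu> (set (var_seq \<beta>))"
  have "meval \<nu>1 \<alpha> = meval \<nu> \<alpha>" "meval \<nu>2 \<beta> = meval \<nu> \<beta>"
    by (auto simp: \<nu>1_def \<nu>2_def intro!: meval_cong)
  then have "meval \<nu>1 \<alpha> \<in> A" "meval \<nu>2 \<beta> \<in> A"
    using ev \<phi> AC[of "meval \<nu> \<alpha>" "meval \<nu> \<beta>"] by auto
  then have "((\<alpha>, \<nu>1), (\<beta>, \<nu>2)) \<in> rows (take k xs) A \<times> rows (drop k xs) A"
    by (auto simp: rows_def k \<nu>1_def \<nu>2_def)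
  moreover have "p = join_rows ((\<alpha>, \<nu>1), (\<beta>, \<nu>2))"
    using \<nu> xs \<phi> by (auto simp: p \<nu>1_def \<nu>2_def fun_eq_iff PiE_def extensional_def)
  ultimately show "p \<in> (\<Union>k\<in>{1..<length xs}. ?J k)"
    using k(3) by blast
next
  fix p assume "p \<in> (\<Union>k\<in>{1..<length xs}. ?J k)"
  then obtain k \<alpha> \<nu> \<beta> \<mu> where k: "k \<in> {1..<length xs}" and p: "p = join_rows ((\<alpha>, \<nu>), (\<beta>, \<mu>))"
    and 1: "(\<alpha>, \<nu>) \<in> rows (take k xs) A" and 2: "(\<beta>, \<mu>) \<in> rows (drop k xs) A"
    by (elim UN_E imageE SigmaE) auto
  have var: "var_seq \<alpha> = take k xs" "var_seq \<beta> = drop k xs"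
    using 1 2 by (auto simp: rows_def)
  have set: "set xs = set (take k xs) \<union> set (drop k xs)"
    by (metis append_take_drop_id set_append)
  have disj: "set (take k xs) \<inter> set (drop k xs) = {}"
    using assms(2) by (simp add: set_take_disj_set_drop_if_distinct)
  define \<rho> where "\<rho> = (\<lambda>i. if i \<in> set (take k xs) then \<nu> i else \<mu> i)"
  have "meval \<rho> \<alpha> = meval \<nu> \<alpha>" "meval \<rho> \<beta> = meval \<mu> \<beta>"
    using disj by (auto simp: \<rho>_def var intro!: meval_cong)
  then have "meval \<rho> (MImp \<alpha> \<beta>) \<in> C"
    using 1 2 AC[of "meval \<nu> \<alpha>" "meval \<mu> \<beta>"] by (simp add: rows_def)
  moreover have "\<rho> \<in> set xs \<rightarrow>\<^sub>E UNIV"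
    using 1 2 by (auto simp: \<rho>_def rows_def set PiE_def extensional_def)
  ultimately show "p \<in> rows xs C"
    by (simp add: p rows_def var \<rho>_def)
qed

lemma card_rows_rec:
  assumes "2 \<le> length xs" "distinct xs"
    and "\<And>a b. (\<not> (a \<and> b)) \<in> C \<longleftrightarrow> a \<in> A \<and> b \<in> A"
  shows "card (rows xs C) =
    (\<Sum>k\<in>{1..<length xs}. card (rows (take k xs) A) * card (rows (drop k xs) A))"
proof -
  let ?J = "\<lambda>k. join_rows ` (rows (take k xs) A \<times> rows (drop k xs) A)"
  \<comment> \<open>The cut can be read off the left subformula, so the images for different
    \<open>k\<close> are disjoint.\<close>
  have "length (case fst p of MImp \<alpha> \<beta> \<Rightarrow> var_seq \<alpha>) = k"
    if "p \<in> ?J k" "k \<in> {1..<length xs}" for k p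
    using that by (auto simp: rows_def)
  then have "?J k \<inter> ?J l = {}" if "k \<in> {1..<length xs}" "l \<in> {1..<length xs}" "k \<noteq> l" for k l
    using that by blast
  moreover have "card (?J k) = card (rows (take k xs) A) * card (rows (drop k xs) A)" for k
    using inj_on_join_rows[of "take k xs" "drop k xs" A A] assms(2)
    by (subst card_image) (auto simp: card_cartesian_product set_take_disj_set_drop_if_distinct)
  ultimately show ?thesis
    unfolding rows_split[OF assms]
    by (subst card_UN_disjoint) (auto simp: finite_rows simp del: image_Int)
qed

lemmas card_rows_UNIV_rec = card_rows_rec[where A = UNIV and C = UNIV, simplified]
lemmas card_rows_False_rec = card_rows_rec[where A = "{True}" and C = "{False}", simplified]

text \<open>Names of variables do not matter. Instead of building a renaming bijection, induction on
  the length uses that both recurrences depend on shorter lists only. The true rows have no such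
  product recurrence and are recovered as the difference of the two counts.\<close>

lemma card_rows_length_cong:
  assumes "distinct xs" "distinct ys" "length xs = length ys"
  shows "card (rows xs UNIV) = card (rows ys UNIV) \<and> card (rows xs {False}) = card (rows ys {False})"
  using assms
proof (induction xs arbitrary: ys rule: length_induct)
  case (1 xs)
  consider "xs = []" | i where "xs = [i]" | "2 \<le> length xs"
    by (cases xs rule: remdups_adj.cases) auto
  then show ?case
  proof cases
    case 1
    then show ?thesis using "1.prems" by simp
  next
    case 2
    then obtain j where "ys = [j]"
      using "1.prems" by (cases ys) auto
    with 2 show ?thesis by (simp add: card_rows_singleton)
  next
    case 3
    have IH: "card (rows zs UNIV) = card (rows zs' UNIV)"
        "card (rows zs {False}) = card (rows zs' {False})"
        "card (rows zs {True}) = card (rows zs' {True})"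
      if "length zs < length xs" "distinct zs" "distinct zs'" "length zs = length zs'" for zs zs'
    proof -
      have *: "card (rows zs UNIV) = card (rows zs' UNIV) \<and>
          card (rows zs {False}) = card (rows zs' {False})"
        by (rule "1.IH"[rule_format]) (use that in auto)
      then show "card (rows zs UNIV) = card (rows zs' UNIV)"
          "card (rows zs {False}) = card (rows zs' {False})"
        by simp_all
      with * show "card (rows zs {True}) = card (rows zs' {True})"
        by (simp add: card_rows_UNIV)
    qed
    have "card (rows (take k xs) A) * card (rows (drop k xs) A) =
        card (rows (take k ys) A) * card (rows (drop k ys) A)"
      if "k \<in> {1..<length xs}" "A = UNIV \<or> A = {True}" for k A
    proof -
      have "length (take k xs) < length xs" "length (drop k xs) < length xs"
        using that by auto
      then have "card (rows (take k xs) A) = card (rows (take k ys) A)"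
          "card (rows (drop k xs) A) = card (rows (drop k ys) A)"
        using that(2) IH(1,3) "1.prems" by (metis distinct_take length_take, metis distinct_drop length_drop)
      then show ?thesis by simp
    qed
    then show ?thesis
      using 3 "1.prems" by (simp add: card_rows_UNIV_rec card_rows_False_rec)
  qed
qed

section \<open>Convolution recurrences for the row counts\<close>

definition total_rows :: "nat \<Rightarrow> nat" where "total_rows n = card (rows [1..<Suc n] UNIV)"
definition true_rows :: "nat \<Rightarrow> nat" where "true_rows n = card (rows [1..<Suc n] {True})"

lemma total_rows_eq: "total_rows n = true_rows n + y_num n"
  by (simp only: total_rows_def true_rows_def y_num_eq_card_rows card_rows_UNIV)

lemma card_rows_distinct:
  assumes "distinct xs"
  shows "card (rows xs UNIV) = total_rows (length xs)" "card (rows xs {True}) = true_rows (length xs)"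
  using card_rows_length_cong[of xs "[1..<Suc (length xs)]"] assms
    card_rows_UNIV[of xs] card_rows_UNIV[of "[1..<Suc (length xs)]"]
  by (auto simp: total_rows_def true_rows_def simp del: upt_Suc)

text \<open>No formula has an empty variable sequence. These zeros later allow the convolutions to
  run over all \<open>k \<le> n\<close>.\<close>

lemma rows_0: "total_rows 0 = 0" "true_rows 0 = 0"
  by (simp_all add: total_rows_def true_rows_def rows_def var_seq_nonempty)

lemma rows_1: "total_rows (Suc 0) = 2" "true_rows (Suc 0) = 1"
  by (simp_all add: total_rows_def true_rows_def card_rows_singleton)

lemma total_rows_rec:
  assumes "2 \<le> n"
  shows "total_rows n = (\<Sum>k\<in>{1..<n}. total_rows k * total_rows (n - k))"
  using card_rows_UNIV_rec[of "[1..<Suc n]"] assms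
  by (auto simp: card_rows_distinct simp flip: total_rows_def simp del: upt_Suc intro!: sum.cong)

lemma y_num_rec:
  assumes "2 \<le> n"
  shows "y_num n = (\<Sum>k\<in>{1..<n}. true_rows k * true_rows (n - k))"
proof -
  have "y_num n = (\<Sum>k\<in>{1..<n}. card (rows (take k [1..<Suc n]) {True}) *
      card (rows (drop k [1..<Suc n]) {True}))"
    using card_rows_False_rec[of "[1..<Suc n]"] assms
    by (simp add: y_num_eq_card_rows del: upt_Suc take_upt drop_upt)
  also have "\<dots> = (\<Sum>k\<in>{1..<n}. true_rows k * true_rows (n - k))"
    by (intro sum.cong refl) (simp add: card_rows_distinct del: upt_Suc take_upt drop_upt)
  finally show ?thesis .
qed


subsection \<open>Coefficient ratios in a quadratic convolution equation\<close>

text \<open>The infimum of the eventual upper bounds is the limit superior of \<open>d\<close>. By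
  \<open>step\<close> it is at most \<open>q\<close> times itself plus any positive error, which
  forces it to be 0.\<close>

lemma contraction_imp_null:
  fixes d :: "nat \<Rightarrow> real"
  assumes nonneg: "\<And>n. 0 \<le> d n" and bound: "\<And>n. d n \<le> B" and q: "q < 1"
    and step: "\<And>M e. 0 \<le> M \<Longrightarrow> 0 < e \<Longrightarrow> eventually (\<lambda>n. d n \<le> M) sequentially \<Longrightarrow>
      eventually (\<lambda>n. d n \<le> q * M + e) sequentially"
  shows "d \<longlonglongrightarrow> 0"
proof -
  define A where "A = {M. eventually (\<lambda>n. d n \<le> M) sequentially}"
  have lb: "0 \<le> M" if "M \<in> A" for M
  proof -
    have "eventually (\<lambda>n. d n \<le> M) sequentially"
      using that by (simp add: A_def)
    then obtain n where "d n \<le> M"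
      using eventually_happens by force
    then show ?thesis using nonneg[of n] by simp
  qed
  then have bdd: "bdd_below A" by (rule bdd_belowI)
  have "B \<in> A" using bound by (simp add: A_def)
  then have ne: "A \<noteq> {}" by blast
  have "Inf A \<le> 0"
  proof (rule ccontr)
    assume "\<not> Inf A \<le> 0"
    define m where "m = Inf A"
    \<comment> \<open>\<open>q\<close> may be negative; replacing it by \<open>p\<close> keeps
      multiplication monotone.\<close>
    define p where "p = max q 0"
    \<comment> \<open>A quarter of the gap between \<open>p * m\<close> and \<open>m\<close>: one
      \<open>e\<close> is spent on \<open>M < m + e\<close>, another on the error in
      \<open>step\<close>, and the total still stays below \<open>m\<close>.\<close>
    define e where "e = (1 - p) * m / 4"
    have m: "m > 0" using \<open>\<not> Inf A \<le> 0\<close> by (simp add: m_def)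
    have p: "0 \<le> p" "p < 1" "q \<le> p" using q by (simp_all add: p_def)
    have e: "e > 0" using m p by (simp add: e_def)
    obtain M where M: "M \<in> A" "M < m + e"
      using cInf_lessD[OF ne, of "m + e"] e unfolding m_def by auto
    have "p * M + e \<in> A"
    proof -
      have "eventually (\<lambda>n. d n \<le> q * M + e) sequentially"
        using step[of M e] M e lb by (simp add: A_def)
      moreover have "q * M \<le> p * M"
        using lb[OF M(1)] p by (intro mult_right_mono) auto
      ultimately show ?thesis
        by (auto simp: A_def elim!: eventually_mono)
    qed
    then have "m \<le> p * M + e"
      unfolding m_def by (rule cInf_lower[OF _ bdd])
    moreover have "p * M \<le> p * (m + e)"
      using M p by (intro mult_left_mono) auto
    moreover have "p * (m + e) \<le> p * m + e"
      using p e by (simp add: distrib_left mult_left_le_one_le)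
    moreover have "p * m + 2 * e < m"
    proof -
      have "m - (p * m + 2 * e) = 2 * e" by (simp add: e_def field_simps)
      then show ?thesis using e by linarith
    qed
    ultimately show False by simp
  qed
  show ?thesis
  proof (rule LIMSEQ_I)
    fix r :: real assume "r > 0"
    then obtain M where M: "M \<in> A" "M < r"
      using cInf_lessD[OF ne, of r] \<open>Inf A \<le> 0\<close> by auto
    then show "\<exists>no. \<forall>n\<ge>no. norm (d n - 0) < r"
      using nonneg unfolding A_def eventually_sequentially by (force simp: abs_of_nonneg)
  qed
qed

text \<open>The reflection of \<open>k\<close> to \<open>n - k\<close> exchanges the first
  \<open>K\<close> terms with the last \<open>K\<close>.\<close>

lemma convolution_split:
  fixes a :: "nat \<Rightarrow> real"
  assumes "2 * K \<le> n"
  shows "(\<Sum>k\<le>n. a k * a (n - k)) =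
    2 * (\<Sum>k<K. a k * a (n - k)) + (\<Sum>k\<in>{K..n-K}. a k * a (n - k))"
proof -
  have "{..n} = ({..<K} \<union> {K..n-K}) \<union> {n-K<..n}"
    using assms by auto
  then have "(\<Sum>k\<le>n. a k * a (n - k)) = (\<Sum>k<K. a k * a (n - k)) +
      (\<Sum>k\<in>{K..n-K}. a k * a (n - k)) + (\<Sum>k\<in>{n-K<..n}. a k * a (n - k))"
    using assms by (simp only:) (subst sum.union_disjoint; auto)+
  also have "(\<Sum>k\<in>{n-K<..n}. a k * a (n - k)) = (\<Sum>k<K. a k * a (n - k))"
    using assms by (intro sum.reindex_bij_witness[of _ "\<lambda>k. n - k" "\<lambda>k. n - k"]) auto
  finally show ?thesis by simp
qed

text \<open>A product of \<open>k\<close> consecutive ratios, each tending to 1. The final change of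
  index removes the truncated subtraction.\<close>

lemma tendsto_shifted_ratio:
  fixes u :: "nat \<Rightarrow> real"
  assumes pos: "\<And>n. 0 < n \<Longrightarrow> 0 < u n" and ratio: "(\<lambda>n. u n / u (Suc n)) \<longlonglongrightarrow> 1"
  shows "(\<lambda>n. u (n - k) / u n) \<longlonglongrightarrow> 1"
proof -
  have "(\<lambda>n. u n / u (n + k)) \<longlonglongrightarrow> 1"
  proof (induction k)
    case 0
    have "eventually (\<lambda>n. u n / u n = 1) sequentially"
      using eventually_gt_at_top[of 0]
    proof eventually_elim
      case (elim n)
      then show ?case using pos[of n] by simp
    qed
    then show ?case by (simp add: tendsto_eventually)
  next
    case (Suc k)
    have "(\<lambda>n. u n / u (n + k) * (u (n + k) / u (Suc (n + k)))) \<longlonglongrightarrow> 1 * 1"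
      by (intro tendsto_mult Suc LIMSEQ_ignore_initial_segment[OF ratio, of k, unfolded add_Suc])
    moreover have "eventually (\<lambda>n. u n / u (n + k) * (u (n + k) / u (Suc (n + k))) =
        u n / u (n + Suc k)) sequentially"
      using eventually_gt_at_top[of 0]
    proof eventually_elim
      case (elim n)
      then have "u (n + k) > 0" using pos by simp
      then show ?case by simp
    qed
    ultimately have "(\<lambda>n. u n / u (n + Suc k)) \<longlonglongrightarrow> 1 * 1"
      by (rule Lim_transform_eventually)
    then show ?case by simp
  qed
  then have "(\<lambda>n. u (n + k - k) / u (n + k)) \<longlonglongrightarrow> 1" by simp
  then show ?thesis by (rule LIMSEQ_offset)
qed

text \<open>
  The hypothesis \<open>conv\<close> says that the middle part of the convolution of \<open>u\<close> with itself is
  negligible; the same then holds for \<open>v \<le> u\<close>.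
\<close>
lemma convolution_root_ratio:
  fixes u v :: "nat \<Rightarrow> real"
  assumes pos: "\<And>n. 0 < n \<Longrightarrow> 0 < u n" and ratio: "(\<lambda>n. u n / u (Suc n)) \<longlonglongrightarrow> 1"
    and u: "u sums U" and conv: "(\<lambda>n. (\<Sum>k\<le>n. u k * u (n - k)) / u n) \<longlonglongrightarrow> 2 * U"
    and v: "v sums S" and S: "2 * S < 1"
    and v_nonneg: "\<And>n. 0 \<le> v n" and v_le: "\<And>n. v n \<le> u n"
    and eq: "eventually (\<lambda>n. v n + (\<Sum>k\<le>n. v k * v (n - k)) = u n) sequentially"
  shows "(\<lambda>n. v n / u n) \<longlonglongrightarrow> 1 / (1 + 2 * S)"
proof -
  have S_ge: "(\<Sum>k<K. v k) \<le> S" for K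
    using v v_nonneg by (metis sum_le_suminf sums_unique sums_summable finite_lessThan)
  have "0 \<le> S" using S_ge[of 0] by simp
  \<comment> \<open>The fixed point of the map sending \<open>t\<close> to
    \<open>1 - 2 * S * t\<close>.\<close>
  define c where "c = 1 / (1 + 2 * S)"
  have c: "0 \<le> c" "c \<le> 1" "1 - c = 2 * S * c"
    using \<open>0 \<le> S\<close> by (simp_all add: c_def field_simps)
  define d where "d n = \<bar>v n / u n - c\<bar>" for n
  have u_nonneg: "0 \<le> u n" for n
    using v_nonneg[of n] v_le[of n] by simp
  have "d \<longlonglongrightarrow> 0"
  proof (rule contraction_imp_null[OF _ _ S])
    show "0 \<le> d n" for n by (simp add: d_def)
    have "0 \<le> v n / u n" "v n / u n \<le> 1" for n
      using v_nonneg[of n] v_le[of n] u_nonneg[of n] by (auto simp: divide_le_eq)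
    then show "d n \<le> 1" for n using c unfolding d_def by (smt (verit))
    fix M e :: real
    assume M: "0 \<le> M" and e: "0 < e" and ev: "eventually (\<lambda>n. d n \<le> M) sequentially"
    \<comment> \<open>Both tails beyond \<open>K\<close> are to be below \<open>e / 8\<close>. Each
      enters the final estimate with a factor of at most 2, so together they cost at most
      \<open>e / 2\<close>.\<close>
    have "eventually (\<lambda>K. \<bar>(\<Sum>k<K. u k) - U\<bar> < e / 8) sequentially"
      using u e unfolding sums_def by (auto dest!: tendstoD[of _ _ _ "e/8"] simp: dist_real_def)
    moreover have "eventually (\<lambda>K. \<bar>(\<Sum>k<K. v k) - S\<bar> < e / 8) sequentially"
      using v e unfolding sums_def by (auto dest!: tendstoD[of _ _ _ "e/8"] simp: dist_real_def)
    ultimately obtain K where K: "\<bar>(\<Sum>k<K. u k) - U\<bar> < e / 8" "\<bar>(\<Sum>k<K. v k) - S\<bar> < e / 8"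
      using eventually_happens[OF eventually_conj, of _ sequentially] by auto
    define W where "W n = (\<Sum>k<K. v k * (u (n - k) / u n))" for n
    define mid where "mid n = (\<Sum>k\<in>{K..n-K}. u k * u (n - k)) / u n" for n
    have W: "W \<longlonglongrightarrow> (\<Sum>k<K. v k * 1)"
      unfolding W_def by (intro tendsto_intros tendsto_shifted_ratio pos ratio)
    \<comment> \<open>Removing both ends from the full convolution, whose limit is given by
      \<open>conv\<close>, shows that the middle part tends to twice the tail of
      \<open>u\<close>.\<close>
    have "(\<lambda>n. (\<Sum>k\<le>n. u k * u (n - k)) / u n - 2 * (\<Sum>k<K. u k * (u (n - k) / u n)))
        \<longlonglongrightarrow> 2 * U - 2 * (\<Sum>k<K. u k * 1)"
      by (intro tendsto_intros tendsto_shifted_ratio conv pos ratio)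
    moreover have "eventually (\<lambda>n. (\<Sum>k\<le>n. u k * u (n - k)) / u n -
        2 * (\<Sum>k<K. u k * (u (n - k) / u n)) = mid n) sequentially"
      using eventually_ge_at_top[of "2 * K"]
      by eventually_elim
        (simp add: convolution_split mid_def add_divide_distrib flip: sum_divide_distrib)
    ultimately have mid: "mid \<longlonglongrightarrow> 2 * U - 2 * (\<Sum>k<K. u k * 1)"
      by (simp add: tendsto_cong)
    have lim: "(\<lambda>n. 2 * M * W n + 2 * c * \<bar>W n - S\<bar> + mid n) \<longlonglongrightarrow>
      2 * M * (\<Sum>k<K. v k * 1) + 2 * c * \<bar>(\<Sum>k<K. v k * 1) - S\<bar> + (2 * U - 2 * (\<Sum>k<K. u k * 1))"
      by (intro tendsto_intros W mid)
    have "2 * M * (\<Sum>k<K. v k) \<le> 2 * M * S"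
      using S_ge M by (intro mult_left_mono) auto
    moreover have "2 * c * \<bar>(\<Sum>k<K. v k) - S\<bar> \<le> 2 * 1 * (e / 8)"
      using c K by (intro mult_mono) auto
    ultimately have "2 * M * (\<Sum>k<K. v k * 1) + 2 * c * \<bar>(\<Sum>k<K. v k * 1) - S\<bar> +
        (2 * U - 2 * (\<Sum>k<K. u k * 1)) < 2 * S * M + e"
      using K(1) e unfolding mult_1_right mult.assoc mult.commute[of S M] by linarith
    then have bound: "eventually (\<lambda>n. 2 * M * W n + 2 * c * \<bar>W n - S\<bar> + mid n < 2 * S * M + e) sequentially"
      by (rule order_tendstoD(2)[OF lim])
    obtain N where N: "\<And>n. N \<le> n \<Longrightarrow> d n \<le> M"
      using ev unfolding eventually_sequentially by auto
    show "eventually (\<lambda>n. d n \<le> 2 * S * M + e) sequentially"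
      \<comment> \<open>For \<open>k < K\<close> this threshold makes \<open>n - k\<close> positive
        and at least \<open>N\<close>, so the bound \<open>M\<close> applies to
        \<open>d (n - k)\<close>.\<close>
      using eq bound eventually_ge_at_top[of "2 * K + N + 1"]
    proof eventually_elim
      case (elim n)
      have un: "u n > 0" using elim(3) pos by simp
      \<comment> \<open>The part of the head due to the deviation of the earlier ratios from
        \<open>c\<close>; it alone carries the factor \<open>M\<close>.\<close>
      define V where "V = (\<Sum>k<K. v k * (u (n - k) / u n) * (v (n - k) / u (n - k) - c))"
      define midv where "midv = (\<Sum>k\<in>{K..n-K}. v k * v (n - k)) / u n"
      have "(\<Sum>k<K. v k * v (n - k)) / u n = (\<Sum>k<K. v k * (u (n - k) / u n) * (v (n - k) / u (n - k)))"
        unfolding sum_divide_distrib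
      proof (rule sum.cong)
        fix k assume "k \<in> {..<K}"
        then have "u (n - k) > 0" using elim(3) by (intro pos) auto
        then show "v k * v (n - k) / u n = v k * (u (n - k) / u n) * (v (n - k) / u (n - k))"
          by simp
      qed simp
      also have "\<dots> = V + c * W n"
        unfolding V_def W_def sum_distrib_left sum.distrib[symmetric]
        by (intro sum.cong) (simp_all add: algebra_simps)
      finally have head: "(\<Sum>k<K. v k * v (n - k)) / u n = V + c * W n" .
      have "v n = u n - 2 * (\<Sum>k<K. v k * v (n - k)) - (\<Sum>k\<in>{K..n-K}. v k * v (n - k))"
        using elim(1,3) convolution_split[of K n v] by simp
      then have "v n / u n = 1 - 2 * ((\<Sum>k<K. v k * v (n - k)) / u n) - midv"
        using un by (simp add: midv_def diff_divide_distrib)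
      \<comment> \<open>The identity \<open>1 - c = 2 * S * c\<close> cancels the constant terms and
        leaves only error terms.\<close>
      then have eq_d: "v n / u n - c = 2 * c * (S - W n) - 2 * V - midv"
        using c(3) unfolding head by (simp add: algebra_simps)
      have "\<bar>V\<bar> \<le> (\<Sum>k<K. v k * (u (n - k) / u n) * M)"
        unfolding V_def
      proof (intro order.trans[OF sum_abs] sum_mono)
        fix k assume "k \<in> {..<K}"
        then have "d (n - k) \<le> M" using elim(3) by (intro N) auto
        then show "\<bar>v k * (u (n - k) / u n) * (v (n - k) / u (n - k) - c)\<bar> \<le> v k * (u (n - k) / u n) * M"
          unfolding abs_mult d_def using v_nonneg u_nonneg
          by (intro mult_mono) (auto simp: abs_mult)
      qed
      also have "\<dots> = M * W n"
        by (simp add: W_def sum_distrib_left mult_ac)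
      finally have V: "\<bar>V\<bar> \<le> M * W n" .
      have "0 \<le> midv" "midv \<le> mid n"
        unfolding midv_def mid_def using un v_nonneg u_nonneg v_le
        by (auto intro!: divide_nonneg_pos sum_nonneg divide_right_mono sum_mono mult_mono)
      moreover have "\<bar>2 * c * (S - W n)\<bar> = 2 * c * \<bar>W n - S\<bar>"
        using c by (simp add: abs_mult abs_minus_commute)
      ultimately have "d n \<le> 2 * c * \<bar>W n - S\<bar> + 2 * (M * W n) + mid n"
        unfolding d_def eq_d using V by linarith
      then show ?case using elim(2) by simp
    qed
  qed
  then have "(\<lambda>n. v n / u n - c) \<longlonglongrightarrow> 0"
    unfolding d_def by (rule tendsto_rabs_zero_cancel)
  then show ?thesis
    unfolding c_def by (rule LIM_zero_cancel)
qed

subsection \<open>Counts normalised by powers of 8\<close>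

text \<open>The coefficients of \<open>(1 - \<surd>(1 - z)) / 2\<close>, where \<open>z = 8 x\<close> for the usual variable \<open>x\<close>.\<close>
definition total_weight :: "nat \<Rightarrow> real" where
  "total_weight n = (if n = 0 then 0 else - (1/2) * ((1/2 gchoose n) * (- 1) ^ n))"

lemma total_weight_simps: "total_weight 0 = 0" "total_weight (Suc 0) = 1/4"
  by (simp_all add: total_weight_def)

text \<open>The ratio of consecutive binomial coefficients. It starts at \<open>n = 1\<close>
  because the value at 0 is overwritten by 0; from there on the factor is positive.\<close>

lemma total_weight_Suc:
  assumes "0 < n"
  shows "total_weight (Suc n) = total_weight n * ((real n - 1/2) / (real n + 1))"
proof -
  have "(1/2 gchoose Suc n) = (1/2 gchoose n) * ((1/2 - real n) / (real n + 1))"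
    using gbinomial_mult_1[of "1/2 :: real" n] by (simp add: field_simps)
  then have "total_weight (Suc n) =
      - (1/2) * ((1/2 gchoose n) * ((1/2 - real n) / (real n + 1)) * (- 1) ^ Suc n)"
    by (simp only: total_weight_def nat.simps if_False)
  also have "\<dots> = - (1/2) * ((1/2 gchoose n) * (- 1) ^ n) * - ((1/2 - real n) / (real n + 1))"
    by simp
  also have "- ((1/2 - real n) / (real n + 1)) = (real n - 1/2) / (real n + 1)"
    by (simp only: minus_divide_left minus_diff_eq)
  finally show ?thesis
    using assms by (simp add: total_weight_def)
qed

lemma total_weight_pos: "0 < n \<Longrightarrow> 0 < total_weight n"
proof (induction n rule: nat_induct_non_zero)
  case 1
  then show ?case by (simp add: total_weight_simps)
next
  case (Suc n)
  then show ?case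
    unfolding total_weight_Suc[OF Suc.hyps]
    by (intro mult_pos_pos divide_pos_pos) auto
qed

lemma total_weight_ratio: "(\<lambda>n. total_weight n / total_weight (Suc n)) \<longlonglongrightarrow> 1"
proof (rule Lim_transform_eventually)
  show "(\<lambda>n. (real n + 1) / (real n - 1/2)) \<longlonglongrightarrow> 1"
    by real_asymp
  show "eventually (\<lambda>n. (real n + 1) / (real n - 1/2) = total_weight n / total_weight (Suc n)) sequentially"
    using eventually_gt_at_top[of 0]
  proof eventually_elim
    case (elim n)
    then show ?case
      using total_weight_pos[of n] by (simp add: total_weight_Suc)
  qed
qed

text \<open>Squaring \<open>sqrt (1 - z)\<close> gives \<open>1 - z\<close>, which has no
  coefficient of index 2 or more. In coefficients this is Vandermonde's identity for the exponents
  1/2 and 1/2.\<close>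

lemma total_weight_convolution:
  assumes "2 \<le> n"
  shows "(\<Sum>k\<le>n. total_weight k * total_weight (n - k)) = total_weight n"
proof -
  define a where "a k = (1/2 gchoose k) * (- 1 :: real) ^ k" for k
  have a0: "a 0 = 1" by (simp add: a_def)
  have split: "{..n} = insert 0 (insert n {1..<n})" using assms by auto
  have "(\<Sum>k\<le>n. a k * a (n - k)) = (\<Sum>k\<le>n. (1/2 gchoose k) * (1/2 gchoose (n - k)) * (- 1) ^ n)"
  proof (intro sum.cong refl)
    fix k assume "k \<in> {..n}"
    then have "(- 1 :: real) ^ n = (- 1) ^ k * (- 1) ^ (n - k)"
      by (simp flip: power_add)
    then show "a k * a (n - k) = (1/2 gchoose k) * (1/2 gchoose (n - k)) * (- 1) ^ n"
      by (simp add: a_def)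
  qed
  also have "\<dots> = (1 gchoose n) * (- 1) ^ n"
    using gbinomial_Vandermonde[of "1/2 :: real" "1/2" n]
    by (simp add: sum_distrib_right[symmetric] atMost_atLeast0)
  also have "(1 gchoose n :: real) = of_nat (1 choose n)"
    by (simp add: binomial_gbinomial)
  also have "1 choose n = 0"
    using assms by (intro binomial_eq_0) simp
  finally have a: "2 * a n + (\<Sum>k\<in>{1..<n}. a k * a (n - k)) = 0"
    using assms unfolding split by (simp add: a0)
  have "(\<Sum>k\<le>n. total_weight k * total_weight (n - k)) =
      (\<Sum>k\<in>{1..<n}. total_weight k * total_weight (n - k))"
    using assms unfolding split by (simp add: total_weight_simps)
  also have "\<dots> = (\<Sum>k\<in>{1..<n}. 1/4 * (a k * a (n - k)))"
    by (intro sum.cong) (auto simp: total_weight_def a_def)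
  also have "\<dots> = - (1/2) * a n"
    using a unfolding sum_distrib_left[symmetric] by simp
  finally show ?thesis
    using assms by (simp add: total_weight_def a_def)
qed

section \<open>Sum and asymptotics of the total weights\<close>

lemma gbinomial_tendsto_powr:
  fixes a :: real
  shows "(\<lambda>n. (a gchoose n) * (- 1) ^ n * real n powr (a + 1)) \<longlonglongrightarrow> inverse (Gamma (- a))"
proof (rule Lim_transform_eventually[OF gbinomial_asymptotic[of a]])
  show "eventually (\<lambda>n. (a gchoose n) / ((- 1) ^ n / exp ((a + 1) * of_real (ln (real n)))) =
      (a gchoose n) * (- 1) ^ n * real n powr (a + 1)) sequentially"
    using eventually_gt_at_top[of 0]
  proof eventually_elim
    case (elim n)
    then show ?case by (cases "even n") (simp_all add: powr_def)
  qed
qed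

text \<open>The alternating partial sums of the binomial coefficients of 1/2 are, up to sign, single
  binomial coefficients of -1/2. These decay like \<open>n powr (-1/2)\<close>, so only the constant
  1/2 survives.\<close>

lemma total_weight_sums: "total_weight sums (1/2)"
proof -
  have "(\<lambda>n. ((-1/2 :: real) gchoose n) * (- 1) ^ n * real n powr (-1/2 + 1) * real n powr (- 1/2))
      \<longlonglongrightarrow> inverse (Gamma (- (-1/2))) * 0"
    by (rule tendsto_mult[OF gbinomial_tendsto_powr]) real_asymp
  moreover have "eventually (\<lambda>n. ((-1/2 :: real) gchoose n) * (- 1) ^ n * real n powr (-1/2 + 1) *
      real n powr (- 1/2) = (- 1) ^ n * (-1/2 gchoose n)) sequentially"
    using eventually_gt_at_top[of 0]
    by eventually_elim (simp add: mult.assoc flip: powr_add)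
  ultimately have "(\<lambda>n. (- 1) ^ n * (-1/2 gchoose n) :: real) \<longlonglongrightarrow> inverse (Gamma (- (-1/2))) * 0"
    by (rule Lim_transform_eventually)
  then have "(\<lambda>n. 1/2 - 1/2 * ((- 1) ^ n * (-1/2 gchoose n)) :: real) \<longlonglongrightarrow>
      1/2 - 1/2 * (inverse (Gamma (- (-1/2))) * 0)"
    by (intro tendsto_diff[OF tendsto_const] tendsto_mult[OF tendsto_const])
  moreover have "(\<Sum>k\<le>n. total_weight k) = 1/2 - 1/2 * ((- 1) ^ n * (-1/2 gchoose n))" for n
  proof -
    \<comment> \<open>The extra 1/2 at \<open>k = 0\<close> cancels the leading binomial term, since
      \<open>total_weight 0\<close> is 0.\<close>
    have "(\<Sum>k\<le>n. total_weight k) =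
        (\<Sum>k\<le>n. (if k = 0 then 1/2 else 0) - 1/2 * ((1/2 gchoose k) * (- 1) ^ k))"
      by (intro sum.cong) (auto simp: total_weight_def)
    also have "\<dots> = 1/2 - 1/2 * (\<Sum>k\<le>n. (1/2 gchoose k) * (- 1) ^ k)"
      by (simp add: sum_subtractf sum_distrib_left)
    finally show ?thesis
      using gbinomial_sum_lower_neg[of "1/2 :: real" n] by simp
  qed
  ultimately show ?thesis
    by (simp add: sums_def_le)
qed

text \<open>The binomial asymptotics for exponent 1/2, with
  \<open>Gamma (- 1/2) = - 2 * sqrt pi\<close> obtained from the functional equation.\<close>

lemma total_weight_asymp: "(\<lambda>n. total_weight n) \<sim>[at_top] (\<lambda>n. 1 / (4 * sqrt (pi * real n ^ 3)))"
proof (rule asymp_equivI')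
  have "- (1/2 :: real) \<notin> \<int>\<^sub>\<le>\<^sub>0"
    using fraction_not_in_Ints[of 2 "-1", where 'a = real] nonpos_Ints_subset_Ints by auto
  then have "Gamma (1/2 :: real) = (- 1/2) * Gamma (- 1/2)"
    using Gamma_plus1[of "-1/2 :: real"] by simp
  then have G: "inverse (Gamma (- (1/2 :: real))) = - (1 / (2 * sqrt pi))"
    by (simp add: Gamma_one_half_real field_simps)
  have "(\<lambda>n. - 2 * sqrt pi * ((1/2 gchoose n) * (- 1) ^ n * real n powr (1/2 + 1))) \<longlonglongrightarrow>
      - 2 * sqrt pi * - (1 / (2 * sqrt pi))"
    unfolding G[symmetric] by (intro tendsto_mult tendsto_const gbinomial_tendsto_powr)
  then have "(\<lambda>n. - 2 * sqrt pi * ((1/2 gchoose n) * (- 1) ^ n * real n powr (1/2 + 1))) \<longlonglongrightarrow> 1"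
    by simp
  moreover have "eventually (\<lambda>n. - 2 * sqrt pi * ((1/2 gchoose n) * (- 1) ^ n * real n powr (1/2 + 1)) =
      total_weight n / (1 / (4 * sqrt (pi * real n ^ 3)))) sequentially"
    using eventually_gt_at_top[of 0]
  proof eventually_elim
    case (elim n)
    have "sqrt (real n ^ 3) = (real n powr 3) powr (1/2)"
      using elim by (simp add: powr_half_sqrt)
    also have "\<dots> = real n powr (1/2 + 1)"
      unfolding powr_powr by simp
    finally have "real n powr (1/2 + 1) = sqrt (real n ^ 3)" ..
    then show ?case
      using elim by (simp add: total_weight_def real_sqrt_mult)
  qed
  ultimately show "(\<lambda>n. total_weight n / (1 / (4 * sqrt (pi * real n ^ 3)))) \<longlonglongrightarrow> 1"
    by (rule Lim_transform_eventually)
qed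

text \<open>Both sides satisfy the same convolution recurrence and agree at 0 and 1. Scaling by
  \<open>8 ^ n\<close> moves the singularity of the generating function to
  \<open>z = 1\<close>.\<close>

lemma total_rows_eq_weight: "real (total_rows n) = 8 ^ n * total_weight n"
proof (induction n rule: less_induct)
  case (less n)
  consider "n = 0" | "n = Suc 0" | "2 \<le> n" by linarith
  then show ?case
  proof cases
    case 3
    have "real (total_rows n) = (\<Sum>k\<in>{1..<n}. real (total_rows k) * real (total_rows (n - k)))"
      by (simp add: total_rows_rec[OF 3])
    also have "\<dots> = (\<Sum>k\<in>{1..<n}. 8 ^ n * (total_weight k * total_weight (n - k)))"
    proof (intro sum.cong refl)
      fix k assume "k \<in> {1..<n}"
      moreover from this have "(8 :: real) ^ n = 8 ^ k * 8 ^ (n - k)"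
        by (simp flip: power_add)
      ultimately show "real (total_rows k) * real (total_rows (n - k)) =
          8 ^ n * (total_weight k * total_weight (n - k))"
        by (simp add: less.IH)
    qed
    also have "\<dots> = 8 ^ n * (\<Sum>k\<le>n. total_weight k * total_weight (n - k))"
    proof -
      have "{..n} = insert 0 (insert n {1..<n})" using 3 by auto
      then show ?thesis
        using 3 by (simp add: total_weight_simps sum_distrib_left)
    qed
    finally show ?thesis by (simp only: total_weight_convolution[OF 3])
  qed (simp_all add: rows_0 rows_1 total_weight_simps)
qed

section \<open>Sum of the true weights and their limiting share\<close>

definition true_weight :: "nat \<Rightarrow> real" where
  "true_weight n = real (true_rows n) / 8 ^ n"

lemma true_weight_simps: "true_weight 0 = 0" "true_weight (Suc 0) = 1/8"
  by (simp_all add: true_weight_def rows_0 rows_1)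

lemma true_weight_nonneg: "0 \<le> true_weight n"
  by (simp add: true_weight_def)

lemma y_num_eq_weight: "real (y_num n) = 8 ^ n * (total_weight n - true_weight n)"
proof -
  have "real (total_rows n) = real (true_rows n) + real (y_num n)"
    by (simp add: total_rows_eq)
  then show ?thesis
    by (simp add: total_rows_eq_weight true_weight_def algebra_simps)
qed

lemma true_weight_le: "true_weight n \<le> total_weight n"
  using y_num_eq_weight[of n] by (smt (verit) of_nat_0_le_iff zero_less_power zero_le_mult_iff)

lemma true_weight_convolution:
  assumes "n \<noteq> Suc 0"
  shows "true_weight n + (\<Sum>k\<le>n. true_weight k * true_weight (n - k)) = total_weight n"
proof (cases "n = 0")
  case True
  then show ?thesis by (simp add: true_weight_simps total_weight_simps)
next
  case False
  with assms have n: "2 \<le> n" by simp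
  have split: "{..n} = insert 0 (insert n {1..<n})" using n by auto
  have "8 ^ n * (\<Sum>k\<le>n. true_weight k * true_weight (n - k)) =
      (\<Sum>k\<in>{1..<n}. 8 ^ n * (true_weight k * true_weight (n - k)))"
    using n unfolding split by (simp add: true_weight_simps sum_distrib_left)
  also have "\<dots> = (\<Sum>k\<in>{1..<n}. real (true_rows k) * real (true_rows (n - k)))"
  proof (intro sum.cong refl)
    fix k assume "k \<in> {1..<n}"
    then have "(8 :: real) ^ n = 8 ^ k * 8 ^ (n - k)"
      by (simp flip: power_add)
    then show "8 ^ n * (true_weight k * true_weight (n - k)) =
        real (true_rows k) * real (true_rows (n - k))"
      by (simp add: true_weight_def)
  qed
  also have "\<dots> = 8 ^ n * (total_weight n - true_weight n)"
    using y_num_rec[OF n] by (simp flip: y_num_eq_weight)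
  finally show ?thesis by simp
qed

text \<open>Summing the convolution identity over all indices, with the Cauchy product for the
  square, gives a quadratic equation for the sum; nonnegativity selects its root.\<close>

lemma true_weight_sums: "true_weight sums ((sqrt (5/2) - 1) / 2)"
proof -
  have "summable true_weight"
    using true_weight_nonneg true_weight_le
    by (intro summable_comparison_test'[OF sums_summable[OF total_weight_sums], of 0]) simp
  then obtain S where S: "true_weight sums S" by blast
  have "(\<lambda>n. \<Sum>k\<le>n. true_weight k * true_weight (n - k)) sums (S * S)"
    using Cauchy_product_sums[of true_weight true_weight] S true_weight_nonneg
    by (simp add: sums_iff)
  \<comment> \<open>At index 1 the convolution vanishes, and 1/8 is the missing difference between
    the weights 1/4 and 1/8.\<close>
  then have "(\<lambda>n. true_weight n + (\<Sum>k\<le>n. true_weight k * true_weight (n - k)) +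
      (if n = Suc 0 then 1/8 else 0)) sums (S + S * S + 1/8)"
    by (intro sums_add S sums_single)
  moreover have "true_weight n + (\<Sum>k\<le>n. true_weight k * true_weight (n - k)) +
      (if n = Suc 0 then 1/8 else 0) = total_weight n" for n
    using true_weight_convolution[of n]
    by (cases "n = Suc 0") (simp_all add: true_weight_simps total_weight_simps)
  ultimately have "total_weight sums (S + S * S + 1/8)" by simp
  then have "S + S * S + 1/8 = 1/2"
    using total_weight_sums sums_unique2 by blast
  then have "(2 * S + 1)\<^sup>2 = 5/2"
    by (simp add: power2_eq_square algebra_simps)
  moreover have "0 \<le> S"
    using S true_weight_nonneg sums_le[OF _ sums_zero S] by simp
  ultimately have "sqrt (5/2) = 2 * S + 1"
    by (intro real_sqrt_unique) simp_all
  then show ?thesis using S by simp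
qed

lemma true_weight_ratio: "(\<lambda>n. true_weight n / total_weight n) \<longlonglongrightarrow> sqrt 10 / 5"
proof -
  \<comment> \<open>This is the contraction condition \<open>2 * S < 1\<close>.\<close>
  have "sqrt (5/2) < 2"
    by (rule real_less_lsqrt) (simp_all add: power2_eq_square)
  then have S: "2 * ((sqrt (5/2) - 1) / 2) < 1" by simp
  \<comment> \<open>The quotient is eventually exactly 1, which is twice the sum 1/2 of the total
    weights.\<close>
  have "eventually (\<lambda>n. (\<Sum>k\<le>n. total_weight k * total_weight (n - k)) / total_weight n = 2 * (1/2)) sequentially"
    using eventually_ge_at_top[of 2]
  proof eventually_elim
    case (elim n)
    then show ?case
      using total_weight_pos[of n] by (simp add: total_weight_convolution)
  qed
  then have conv: "(\<lambda>n. (\<Sum>k\<le>n. total_weight k * total_weight (n - k)) / total_weight n) \<longlonglongrightarrow> 2 * (1/2)"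
    by (rule tendsto_eventually)
  have eq: "eventually (\<lambda>n. true_weight n + (\<Sum>k\<le>n. true_weight k * true_weight (n - k)) =
      total_weight n) sequentially"
    using eventually_gt_at_top[of "Suc 0"]
    by eventually_elim (simp add: true_weight_convolution)
  have "(\<lambda>n. true_weight n / total_weight n) \<longlonglongrightarrow> 1 / (1 + 2 * ((sqrt (5/2) - 1) / 2))"
    by (rule convolution_root_ratio[OF total_weight_pos total_weight_ratio total_weight_sums
          conv true_weight_sums S true_weight_nonneg true_weight_le eq])
  also have "1 / (1 + 2 * ((sqrt (5/2) - 1) / 2)) = 1 / sqrt (5/2)"
    by (subst times_divide_eq_right, subst nonzero_mult_div_cancel_left) simp_all
  also have "\<dots> = sqrt 10 / 5"
  proof -
    have "sqrt 10 * sqrt (5/2) = sqrt (5\<^sup>2)" by (simp flip: real_sqrt_mult)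
    then show ?thesis by (simp add: field_simps del: real_sqrt_mult)
  qed
  finally show ?thesis .
qed

section \<open>Asymptotics of the false rows\<close>

theorem theorem3p3:
  "(\<lambda>n::nat. real (y_num n)) \<sim>[at_top]
   (\<lambda>n::nat. ((10 - 2 * sqrt 10) / 10) * (2 ^ (3 * n - 2) / sqrt (pi * real n ^ 3)))"
proof -
  define c where "c = (10 - 2 * sqrt 10) / 10"
  \<comment> \<open>A limit yields an asymptotic equivalence to a constant only if that constant is
    nonzero.\<close>
  have "sqrt 10 < 5" by (rule real_less_lsqrt) simp_all
  then have "c \<noteq> 0" by (simp add: c_def)
  have "(\<lambda>n. 1 - true_weight n / total_weight n) \<longlonglongrightarrow> 1 - sqrt 10 / 5"
    by (intro tendsto_intros true_weight_ratio)
  then have "(\<lambda>n. 1 - true_weight n / total_weight n) \<longlonglongrightarrow> c"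
    by (simp add: c_def diff_divide_distrib)
  then have "(\<lambda>n. 1 - true_weight n / total_weight n) \<sim>[at_top] (\<lambda>_. c)"
    using \<open>c \<noteq> 0\<close> by (simp add: tendsto_imp_asymp_equiv_const)
  then have *: "(\<lambda>n. (1 - true_weight n / total_weight n) * (8 ^ n * total_weight n)) \<sim>[at_top]
      (\<lambda>n. c * (8 ^ n * (1 / (4 * sqrt (pi * real n ^ 3)))))"
    by (intro asymp_equiv_intros total_weight_asymp)
  have lhs: "eventually (\<lambda>n. (1 - true_weight n / total_weight n) * (8 ^ n * total_weight n) =
      real (y_num n)) sequentially"
    using eventually_gt_at_top[of 0]
  proof eventually_elim
    case (elim n)
    then show ?case
      using total_weight_pos[of n] by (simp add: y_num_eq_weight field_simps)
  qed
  have rhs: "eventually (\<lambda>n. c * (8 ^ n * (1 / (4 * sqrt (pi * real n ^ 3)))) =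
      c * (2 ^ (3 * n - 2) / sqrt (pi * real n ^ 3))) sequentially"
    using eventually_gt_at_top[of 0]
  proof eventually_elim
    case (elim n)
    \<comment> \<open>For positive \<open>n\<close> the subtraction in \<open>3 * n - 2\<close> is
      not truncated, and the 4 in the denominator accounts for the exponent
      \<open>- 2\<close>.\<close>
    have "(8 :: real) ^ n = 2 ^ (3 * n)" by (simp add: power_mult)
    also have "3 * n = 3 * n - 2 + 2" using elim by simp
    also have "(2 :: real) ^ (3 * n - 2 + 2) = 4 * 2 ^ (3 * n - 2)" by (simp add: power_add)
    finally show ?case by simp
  qed
  show ?thesis
    using *[unfolded asymp_equiv_cong[OF lhs rhs]] by (simp only: c_def)
qed

end
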